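(* Let $m<n$ be positive integers and let $a,b,c\in\{1,\ldots,m\}^*$ be words. Then $a\,m\,b\,n\,c\sim a\,n\,b\,m\,c$.
   Context: $\mathbb{P}$ is the positive integers; $\mathbb{P}^*$ the finite words over $\mathbb{P}$, juxtaposition is concatenation. Generalized factor order: $u\le w$ iff there is a factor $w'$ of $w$ (consecutive letters) with $|w'|=|u|$ and $u_i\le w'_i$ for all $i$. The weight of $w=w_1\cdots w_\ell$ is $t^\ell x^{w_1+\cdots+w_\ell}$ and $F(u;t,x)=\sum_{w\ge u}\mathrm{wt}(w)$. $u\sim v$ (Wilf equivalence) means $F(u;t,x)=F(v;t,x)$. *)

theory Defs
  imports "HOL-Analysis.Infinite_Sum" "HOL-Library.Sublist"
begin

text \<open>
  Words are lists of natural numbers; the condition that all letters are positive is carried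
  by membership in \<open>lists {1..}\<close> and by the finite alphabet \<open>lists {1..m}\<close>.
\<close>

definition pos_words :: "nat list set" where
  "pos_words = lists {1..}"

definition gfo_le :: "nat list \<Rightarrow> nat list \<Rightarrow> bool" (infix \<open>\<le>\<^sub>f\<close> 50) where
  "u \<le>\<^sub>f w \<longleftrightarrow> (\<exists>w'. sublist w' w \<and> list_all2 (\<le>) u w')"

text \<open>
  Elements of \<open>\<int>[[t,x]]\<close> are power series in the outer indeterminate \<open>x\<close> whose coefficients are
  power series in the inner indeterminate \<open>t\<close>, so \<open>fps_nth (fps_nth G s) l\<close> is the
  coefficient of \<open>t^l x^s\<close>.  The nesting order matters: the library topology on
  power series treats the coefficients as discrete, and only finitely many words of positive
  letters have a given sum (whereas infinitely many have a given length), so with \<open>x\<close>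
  outermost the sum below converges; see \<open>wt_has_sum_F\<close>.
\<close>

definition wt :: "nat list \<Rightarrow> int fps fps" where
  "wt w = fps_const (fps_X ^ length w) * fps_X ^ sum_list w"

definition F :: "nat list \<Rightarrow> int fps fps" where
  "F u = infsum wt {w \<in> pos_words. u \<le>\<^sub>f w}"

definition wilf_equiv :: "nat list \<Rightarrow> nat list \<Rightarrow> bool" (infix \<open>\<sim>\<^sub>W\<close> 50) where
  "u \<sim>\<^sub>W v \<longleftrightarrow> F u = F v"

lemma fps_nth_wt: "fps_nth (wt w) s = (if s = sum_list w then fps_X ^ length w else 0)"
  by (auto simp: wt_def fps_X_power_nth)

lemma length_le_sum_list: "w \<in> pos_words \<Longrightarrow> length w \<le> sum_list w"
  by (induction w) (auto simp: pos_words_def)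

lemma finite_pos_words_sum: "finite {w \<in> pos_words. sum_list w = s}"
proof (rule finite_subset)
  show "{w \<in> pos_words. sum_list w = s} \<subseteq> {w. set w \<subseteq> {..s} \<and> length w \<le> s}"
    using length_le_sum_list member_le_sum_list by fastforce
  show "finite {w. set w \<subseteq> {..s} \<and> length w \<le> s}"
    by (rule finite_lists_length_le) simp
qed

lemma wt_has_sum_F: "(wt has_sum F u) {w \<in> pos_words. u \<le>\<^sub>f w}"
  and fps_nth_F: "fps_nth (F u) s =
    (\<Sum>w | w \<in> pos_words \<and> u \<le>\<^sub>f w \<and> sum_list w = s. fps_X ^ length w)"
proof -
  define G where "G = Abs_fps (\<lambda>s. \<Sum>w | w \<in> pos_words \<and> u \<le>\<^sub>f w \<and> sum_list w = s.
    fps_X ^ length w :: int fps)"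
  have fin: "finite {w. w \<in> pos_words \<and> u \<le>\<^sub>f w \<and> sum_list w = s}" for s
    by (rule finite_subset[OF _ finite_pos_words_sum[of s]]) auto
  have *: "(wt has_sum G) {w \<in> pos_words. u \<le>\<^sub>f w}"
    unfolding has_sum_def tendsto_fps_iff
  proof
    fix s
    let ?A = "{w \<in> pos_words. u \<le>\<^sub>f w}" and ?B = "{w. w \<in> pos_words \<and> u \<le>\<^sub>f w \<and> sum_list w = s}"
    have "fps_nth (sum wt X) s = fps_nth G s" if "finite X" "?B \<subseteq> X" "X \<subseteq> ?A" for X
    proof -
      have "fps_nth (sum wt X) s = (\<Sum>w\<in>X. if s = sum_list w then fps_X ^ length w else 0)"
        by (simp add: fps_sum_nth fps_nth_wt)
      also have "\<dots> = (\<Sum>w\<in>?B. fps_X ^ length w)"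
        using that by (intro sum.mono_neutral_cong_right) auto
      finally show ?thesis by (simp add: G_def)
    qed
    then show "\<forall>\<^sub>F X in finite_subsets_at_top ?A. fps_nth (sum wt X) s = fps_nth G s"
      unfolding eventually_finite_subsets_at_top using fin[of s]
      by (intro exI[of _ ?B]) auto
  qed
  then have "F u = G" by (simp add: F_def infsumI)
  then show "(wt has_sum F u) {w \<in> pos_words. u \<le>\<^sub>f w}"
    and "fps_nth (F u) s =
      (\<Sum>w | w \<in> pos_words \<and> u \<le>\<^sub>f w \<and> sum_list w = s. fps_X ^ length w)"
    using * by (simp_all add: G_def)
qed

end

theory Submission
  imports Defs "HOL-Combinatorics.Permutations"
begin

text \<open>
  Both words arise from \<open>p = a m b m c\<close>, whose letters are at most \<open>m\<close>, by raising one of two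
  letters \<open>m\<close> to \<open>n\<close>.  The positions at which \<open>p\<close> embeds in \<open>w\<close> depend only on the truncation
  of \<open>w\<close> at \<open>m\<close>, hence do not change when letters \<open>\<ge> m\<close> of \<open>w\<close> are permuted among
  themselves.  If \<open>S\<close> is this set of positions and the raised letter has index \<open>i\<close>, then \<open>w\<close> lies
  above the raised word iff a letter \<open>\<ge> n\<close> occurs in \<open>i + S\<close>.  For two indices \<open>i\<close>, \<open>j\<close> the
  sets \<open>i + S\<close> and \<open>j + S\<close> have the same size and carry letters \<open>\<ge> m\<close> only, so a permutation
  of the letters \<open>\<ge> m\<close>, chosen as a function of the truncation, exchanges the two conditions.
\<close>

text \<open>The complements of \<open>A\<close> and \<open>B\<close> in \<open>M\<close> have equal
  size too, so a bijection from \<open>A\<close> to \<open>B\<close> and one between the complements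
  glue to a permutation of \<open>M\<close>.\<close>

lemma ex_permutes_image_eq:
  assumes "finite M" "A \<subseteq> M" "B \<subseteq> M" "card A = card B"
  shows "\<exists>\<sigma>. \<sigma> permutes M \<and> \<sigma> ` A = B"
proof -
  have fin: "finite A" "finite B"
    using assms finite_subset by blast+
  obtain f where f: "bij_betw f A B"
    using finite_same_card_bij[OF fin assms(4)] by blast
  have "card (M - A) = card (M - B)"
    using assms fin by (simp add: card_Diff_subset)
  then obtain g where g: "bij_betw g (M - A) (M - B)"
    using finite_same_card_bij[of "M - A" "M - B"] assms(1) by blast
  define \<sigma> where "\<sigma> x = (if x \<in> A then f x else if x \<in> M then g x else x)" for x
  have A: "bij_betw \<sigma> A B"
    using f by (rule bij_betw_cong[THEN iffD1, rotated]) (simp add: \<sigma>_def)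
  have "bij_betw \<sigma> (M - A) (M - B)"
    using g by (rule bij_betw_cong[THEN iffD1, rotated]) (simp add: \<sigma>_def)
  with A have "bij_betw \<sigma> (A \<union> (M - A)) (B \<union> (M - B))"
    by (rule bij_betw_combine) blast
  then have "bij_betw \<sigma> M M"
    using assms by (simp add: Un_absorb1)
  moreover have "\<sigma> x = x" if "x \<notin> M" for x
    using that assms(2) by (auto simp: \<sigma>_def)
  ultimately have "\<sigma> permutes M"
    by (rule bij_imp_permutes)
  then show ?thesis
    using A by (auto simp: bij_betw_def)
qed

definition embeddings :: "nat list \<Rightarrow> nat list \<Rightarrow> nat set" where
  "embeddings u w = {s. s + length u \<le> length w \<and> (\<forall>k<length u. u ! k \<le> w ! (s + k))}"

lemma finite_embeddings: "finite (embeddings u w)"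
  by (rule finite_subset[of _ "{..length w}"]) (auto simp: embeddings_def)

lemma gfo_le_iff_embeddings: "u \<le>\<^sub>f w \<longleftrightarrow> embeddings u w \<noteq> {}"
proof
  assume "u \<le>\<^sub>f w"
  then obtain w' ps ss where "list_all2 (\<le>) u w'" "w = ps @ w' @ ss"
    by (auto simp: gfo_le_def sublist_def)
  then have "length ps \<in> embeddings u w"
    by (auto simp: embeddings_def list_all2_conv_all_nth nth_append)
  then show "embeddings u w \<noteq> {}"
    by blast
next
  assume "embeddings u w \<noteq> {}"
  then obtain s where s: "s + length u \<le> length w" "\<forall>k<length u. u ! k \<le> w ! (s + k)"
    by (auto simp: embeddings_def)
  have "list_all2 (\<le>) u (take (length u) (drop s w))"
    using s by (auto simp: list_all2_conv_all_nth)
  moreover have "sublist (take (length u) (drop s w)) w"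
    by (meson sublist_drop sublist_order.order_trans sublist_take)
  ultimately show "u \<le>\<^sub>f w"
    unfolding gfo_le_def by blast
qed

text \<open>A letter that is at most \<open>m\<close> lies below \<open>min m x\<close> iff it lies
  below \<open>x\<close>.\<close>

lemma embeddings_map_min:
  assumes "set p \<subseteq> {..m}"
  shows "embeddings p (map (min m) w) = embeddings p w"
proof -
  have "p ! k \<le> m" if "k < length p" for k
    using assms that nth_mem by blast
  then show ?thesis
    by (auto simp: embeddings_def)
qed

text \<open>As \<open>p ! i \<le> n\<close>, raising this letter keeps all constraints on an
  embedding at \<open>s\<close> and adds the single constraint
  \<open>n \<le> w ! (i + s)\<close>.\<close>

lemma gfo_le_list_update_iff:
  assumes "i < length p" "p ! i \<le> n"
  shows "p[i := n] \<le>\<^sub>f w \<longleftrightarrow> (\<exists>k\<in>(+) i ` embeddings p w. n \<le> w ! k)"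
proof -
  have "(\<forall>k<length p. p[i := n] ! k \<le> w ! (s + k)) \<longleftrightarrow>
      (\<forall>k<length p. p ! k \<le> w ! (s + k)) \<and> n \<le> w ! (i + s)" for s
    using assms by (auto simp: nth_list_update add.commute intro: order_trans)
  then show ?thesis
    by (auto simp: gfo_le_iff_embeddings embeddings_def)
qed

text \<open>Only letters \<open>\<ge> m\<close> are moved, onto positions of such letters, and all
  of them truncate to \<open>m\<close>.\<close>

lemma map_min_permute_list:
  fixes m :: "'a::linorder"
  assumes "\<sigma> permutes {k. k < length w \<and> m \<le> w ! k}"
  shows "map (min m) (permute_list \<sigma> w) = map (min m) w"
proof (rule nth_equalityI)
  let ?M = "{k. k < length w \<and> m \<le> w ! k}"
  fix k
  assume "k < length (map (min m) (permute_list \<sigma> w))"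
  then have k: "k < length w"
    by simp
  have "\<sigma> permutes {..<length w}"
    using assms by (rule permutes_subset) auto
  then have "map (min m) (permute_list \<sigma> w) ! k = min m (w ! \<sigma> k)"
    using k by (simp add: permute_list_nth)
  also have "\<dots> = min m (w ! k)"
  proof (cases "k \<in> ?M")
    case True
    then have "\<sigma> k \<in> ?M"
      using permutes_in_image[OF assms] by blast
    then show ?thesis
      using True by (simp add: min_absorb1)
  next
    case False
    then show ?thesis
      using permutes_not_in[OF assms] by simp
  qed
  finally show "map (min m) (permute_list \<sigma> w) ! k = map (min m) w ! k"
    using k by simp
qed simp

lemma wilf_equiv_list_update:
  assumes p: "set p \<subseteq> {..m}" and i: "i < length p" "p ! i = m"
    and j: "j < length p" "p ! j = m" and "m \<le> n"
  shows "p[i := n] \<sim>\<^sub>W p[j := n]"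
proof -
  define M where "M w = {k. k < length w \<and> m \<le> w ! k}" for w :: "nat list"
  \<comment> \<open>The direction from \<open>j\<close> to \<open>i\<close> fits
    \<open>permute_list\<close>, whose result has at position \<open>k\<close> the letter formerly
    at \<open>\<sigma> w k\<close>.\<close>
  define \<sigma> where "\<sigma> w = (SOME \<sigma>. \<sigma> permutes M w \<and>
    \<sigma> ` (+) j ` embeddings p w = (+) i ` embeddings p w)" for w
  define tr where "tr = map (min m)"
  \<comment> \<open>An embedding at \<open>s\<close> places the letter \<open>m = p ! k\<close>
    below \<open>w ! (k + s)\<close>. The two image sets are translates of one set, hence equal in
    size.\<close>
  have "(+) k ` embeddings p w \<subseteq> M w" if "k < length p" "p ! k = m" for k w
    using that by (auto simp: M_def embeddings_def add.commute)
  then have "\<exists>\<sigma>. \<sigma> permutes M w \<and> \<sigma> ` (+) j ` embeddings p w = (+) i ` embeddings p w" for w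
    using i j by (intro ex_permutes_image_eq) (auto simp: M_def card_image)
  then have *: "\<sigma> w permutes M w \<and> \<sigma> w ` (+) j ` embeddings p w = (+) i ` embeddings p w" for w
    unfolding \<sigma>_def by (rule someI_ex)
  have M_tr: "M (tr w) = M w" for w
    by (auto simp: M_def tr_def)
  have emb_tr: "embeddings p (tr w) = embeddings p w" for w
    unfolding tr_def using p by (rule embeddings_map_min)
  have perm: "\<sigma> (tr w) permutes M w"
    and image: "\<sigma> (tr w) ` (+) j ` embeddings p w = (+) i ` embeddings p w" for w
    using *[of "tr w"] by (simp_all add: M_tr emb_tr)
  have perm_inv: "inv (\<sigma> (tr w)) permutes M w" for w
    using perm by (rule permutes_inv)
  have lessThan: "\<tau> permutes {..<length w}" if "\<tau> permutes M w" for \<tau> w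
    using that by (rule permutes_subset) (auto simp: M_def)
  have tr_permute: "tr (permute_list \<tau> w) = tr w" if "\<tau> permutes M w" for \<tau> w
    using that unfolding tr_def M_def by (rule map_min_permute_list)

  \<comment> \<open>Evaluating \<open>\<sigma>\<close> at \<open>tr w\<close> rather than at
    \<open>w\<close> makes \<open>\<phi>\<close> invertible: \<open>\<phi> w\<close> and
    \<open>w\<close> have the same truncation, so \<open>\<psi>\<close> recovers the permutation
    that was applied.\<close>
  define \<phi> where "\<phi> w = permute_list (\<sigma> (tr w)) w" for w
  define \<psi> where "\<psi> w = permute_list (inv (\<sigma> (tr w))) w" for w
  have \<psi>\<phi>: "\<psi> (\<phi> w) = w" for w
  proof -
    have "\<psi> (\<phi> w) = permute_list (\<sigma> (tr w) \<circ> inv (\<sigma> (tr w))) w"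
      using tr_permute[OF perm, of w] permute_list_compose[OF lessThan[OF perm_inv]]
      by (simp add: \<phi>_def \<psi>_def)
    then show ?thesis
      by (simp add: permutes_inv_o[OF perm])
  qed
  have \<phi>\<psi>: "\<phi> (\<psi> w) = w" for w
  proof -
    have "\<phi> (\<psi> w) = permute_list (inv (\<sigma> (tr w)) \<circ> \<sigma> (tr w)) w"
      using tr_permute[OF perm_inv, of w] permute_list_compose[OF lessThan[OF perm]]
      by (simp add: \<phi>_def \<psi>_def)
    then show ?thesis
      by (simp add: permutes_inv_o[OF perm])
  qed
  have mset_\<phi>: "mset (\<phi> w) = mset w" for w
    unfolding \<phi>_def by (rule mset_permute_list[OF lessThan[OF perm]])
  have len_\<phi>: "length (\<phi> w) = length w" for w
    by (simp add: \<phi>_def)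
  have sum_\<phi>: "sum_list (\<phi> w) = sum_list w" for w
    by (metis mset_\<phi> sum_mset_sum_list)
  have pos_\<phi>: "\<phi> w \<in> pos_words \<longleftrightarrow> w \<in> pos_words" for w
    using mset_eq_setD[OF mset_\<phi>] by (simp add: pos_words_def lists_eq_set)
  have le_\<phi>: "p[j := n] \<le>\<^sub>f \<phi> w \<longleftrightarrow> p[i := n] \<le>\<^sub>f w" for w
  proof -
    have emb: "embeddings p (\<phi> w) = embeddings p w"
      by (metis emb_tr \<phi>_def tr_permute[OF perm])
    \<comment> \<open>The index is in range: \<open>k = j + s\<close> with
      \<open>j < length p\<close> and \<open>s + length p \<le> length w\<close>.\<close>
    have nth: "\<phi> w ! k = w ! \<sigma> (tr w) k" if "k \<in> (+) j ` embeddings p w" for k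
      using that j(1) unfolding \<phi>_def
      by (intro permute_list_nth[OF lessThan[OF perm]]) (auto simp: embeddings_def)
    have "p[j := n] \<le>\<^sub>f \<phi> w \<longleftrightarrow> (\<exists>k\<in>(+) j ` embeddings p w. n \<le> \<phi> w ! k)"
      using j \<open>m \<le> n\<close> by (simp add: gfo_le_list_update_iff emb)
    also have "\<dots> \<longleftrightarrow> (\<exists>k\<in>(+) j ` embeddings p w. n \<le> w ! \<sigma> (tr w) k)"
      using nth by (intro bex_cong) auto
    also have "\<dots> \<longleftrightarrow> (\<exists>k\<in>\<sigma> (tr w) ` (+) j ` embeddings p w. n \<le> w ! k)"
      by blast
    also have "\<dots> \<longleftrightarrow> p[i := n] \<le>\<^sub>f w"
      using i \<open>m \<le> n\<close> by (simp only: image gfo_le_list_update_iff)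
    finally show ?thesis .
  qed
  \<comment> \<open>For each letter sum \<open>s\<close>, \<open>\<phi>\<close> maps the words above
    \<open>p[i := n]\<close> bijectively onto those above \<open>p[j := n]\<close> and preserves
    length, so the coefficients agree.\<close>
  have "fps_nth (F (p[i := n])) s = fps_nth (F (p[j := n])) s" for s
    unfolding fps_nth_F
  proof (rule sum.reindex_bij_witness[where i = \<psi> and j = \<phi>])
    fix w
    assume "w \<in> {w. w \<in> pos_words \<and> p[j := n] \<le>\<^sub>f w \<and> sum_list w = s}"
    then show "\<psi> w \<in> {w. w \<in> pos_words \<and> p[i := n] \<le>\<^sub>f w \<and> sum_list w = s}"
      using pos_\<phi>[of "\<psi> w"] le_\<phi>[of "\<psi> w"] sum_\<phi>[of "\<psi> w"] by (simp add: \<phi>\<psi>)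
  qed (simp_all add: \<psi>\<phi> \<phi>\<psi> pos_\<phi> le_\<phi> sum_\<phi> len_\<phi>)
  then show ?thesis
    by (simp add: wilf_equiv_def fps_eq_iff)
qed

theorem theorem4p3:
  fixes m n :: nat and a b c :: "nat list"
  assumes "0 < m" and "m < n"
    and "a \<in> lists {1..m}" and "b \<in> lists {1..m}" and "c \<in> lists {1..m}"
  shows "a @ [m] @ b @ [n] @ c \<sim>\<^sub>W a @ [n] @ b @ [m] @ c"
proof -
  let ?p = "a @ [m] @ b @ [m] @ c"
  have "set ?p \<subseteq> {..m}"
    using assms by (auto simp: lists_eq_set)
  \<comment> \<open>Counting from 0, these are the positions of the second and the first displayed
    \<open>m\<close> in \<open>?p\<close>.\<close>
  then have "?p[length a + Suc (length b) := n] \<sim>\<^sub>W ?p[length a := n]"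
    using assms(2) by (intro wilf_equiv_list_update) (auto simp: nth_append)
  then show ?thesis
    by (simp add: list_update_append)
qed

end
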